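(* Let $\widetilde X(t)$ denote the process corresponding to fully stochastic switching with up to $M$ switches, and for $m\in\{0,\dots,M\}$ let $\widehat X_m(t)$ be the local volatility process encoding parameter randomisation and exactly $m$ stochastic switches (both as defined in the context). Then the characteristic function of $\widetilde X(t)$ is $$\varphi(u;\widetilde X(t))=\sum_{m=0}^M\varphi(u;\widehat X_m(t))\,p_{\mathcal M(t)}(m),$$ where $p_{\mathcal M(t)}$ is the probability mass function of the number of switches $\mathcal M(t)$ at time $t$.
   Context: Notation: $f(x;Z)$ is the probability density function of $Z$ at $x$ and $\varphi(u;Z)=\mathbb{E}[e^{iuZ}]$. Fixed number $m$ of switches. Fix $x_0\in\mathbb{R}$, $\lambda\ge0$, a cdf $F_\eta$, and for $j\in\{0,\dots,M\}$ real-valued functions $b_j(t,z),\sigma_j(t,z)$, finite for all $t\ge0$ and bounded for all $z\in\mathbb{R}$. For positive sojourn times $\bm z=(z_1,\dots,z_m)$ let $\tau_0=0$, $\tau_j=\sum_{k=1}^jz_k$ ($\tau_{m+1}=\infty$), and let $s_j^{\bm z}(t)=0$ for $t<\tau_j$, $t-\tau_j$ for $\tau_j\le t<\tau_{j+1}$, $\tau_{j+1}-\tau_j$ for $t\ge\tau_{j+1}$. For $\bm\theta=(\theta_0,\dots,\theta_m)$ put $\beta(t;\bm z,\bm\theta)=\sum_{j=0}^mb_j(s_j^{\bm z}(t),\theta_j)\mathbf 1_{t\in[\tau_j,\tau_{j+1})}$, $\gamma(t;\bm z,\bm\theta)=\sum_{j=0}^m\sigma_j(s_j^{\bm z}(t),\theta_j)\mathbf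 1_{t\in[\tau_j,\tau_{j+1})}$, and let $X^{\bm z,\bm\theta}$ solve $\mathrm{d}X=\beta(t;\bm z,\bm\theta)\mathrm{d}t+\gamma(t;\bm z,\bm\theta)\mathrm{d}\widetilde W(t)+\mathrm{d}\sum_{i=1}^{\widetilde P(t)}\pi(i)$, $X(0)=x_0$, with $\widetilde W$ a standard Brownian motion, $\widetilde P$ a Poisson process with intensity $\lambda$, and i.i.d. jump sizes $\pi(i)$ with cdf $F_\eta$, all independent. Given, for this $m$, constants $\theta_{j,n}\in\mathbb{R}$, $w_{j,n}\in\mathbb{R}_+$ ($0\le j\le m$, $1\le n\le N_j$, $\sum_nw_{j,n}=1$) and positive constants $z^{\ell_1,\dots,\ell_{k-1}}_{\ell_k},v^{\ell_1,\dots,\ell_{k-1}}_{\ell_k}$ ($1\le k\le m$, $1\le\ell_i\le L_i$, $\sum_{\ell_k}v^{\ell_1,\dots,\ell_{k-1}}_{\ell_k}=1$), write $\bm z_{\bm\ell}=(z_{\ell_1},\dots,z^{\ell_1,\dots,\ell_{m-1}}_{\ell_m})$, $V_{\bm\ell}=\prod_{k=1}^mv^{\ell_1,\dots,\ell_{k-1}}_{\ell_k}$, $\bm\theta_{\bm n}=(\theta_{0,n_0},\dots,\theta_{m,n_m})$, $w_{\bm n}=\prod_{j=0}^mw_{j,n_j}$. The process $\widehat X_m(t)$ is the strong solution of $$\mathrm{d}\widehat X_m(t)=\widehat\mu_m(t,\widehat X_m(t))\mathrm{d}t+\widehat\sigma_m(t,\widehat X_m(t))\mathrm{d}\widehat W(t)+\widehat\eta(t)\mathrm{d}\widehat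 N(t),\quad\widehat X_m(0)=x_0,$$ with $\widehat W$ a standard Brownian motion, $\widehat N$ Poisson with intensity $\lambda$, jump sizes with cdf $F_\eta$, and $$\widehat\mu_m(t,x)=\frac{\sum_{\bm\ell,\bm n}V_{\bm\ell}w_{\bm n}\beta(t;\bm z_{\bm\ell},\bm\theta_{\bm n})f(x;X^{\bm z_{\bm\ell},\bm\theta_{\bm n}}(t))}{\sum_{\bm\ell,\bm n}V_{\bm\ell}w_{\bm n}f(x;X^{\bm z_{\bm\ell},\bm\theta_{\bm n}}(t))},\quad\widehat\sigma_m^2(t,x)=\frac{\sum_{\bm\ell,\bm n}V_{\bm\ell}w_{\bm n}\gamma^2(t;\bm z_{\bm\ell},\bm\theta_{\bm n})f(x;X^{\bm z_{\bm\ell},\bm\theta_{\bm n}}(t))}{\sum_{\bm\ell,\bm n}V_{\bm\ell}w_{\bm n}f(x;X^{\bm z_{\bm\ell},\bm\theta_{\bm n}}(t))}.$$ (For $m=0$ there are no sojourn times and the $\bm\ell$-sums are absent.) Random number of switches. Let $\zeta_1,\dots,\zeta_M$ be independent positive random variables (sojourn times), independent of the Brownian motions $\widetilde W,\widehat W$, the Poisson processes $\widetilde P,\widehat N$ and the jump sizes $\pi(i),\widehat\eta$. $\mathcal M(t)$ is the random number of switches up to time $t$, with values in $\{0,1,\dots,M\}$ and distribution determined by $\mathbb{P}[\mathcal M(t)\le m]=1-\mathbb{P}[\sum_{\ell=1}^{m+1}\zeta_\ell\le t]$ for $m<M$; $p_{\mathcal M(t)}$ is its probability mass function. Fully stochastic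 switching: $\widetilde X(t)$ is the local-volatility-type model in which the number of switches is random: conditionally on $\mathcal M(t)=m$, $\widetilde X(t)$ has the law of $\widehat X_m(t)$, $m\in\{0,\dots,M\}$. *)

theory Defs
  imports "HOL-Probability.Probability"
begin

section \<open>Driving noise\<close>

definition events_of :: "'a measure \<Rightarrow> 'i set \<Rightarrow> ('i \<Rightarrow> 'a \<Rightarrow> real) \<Rightarrow> 'a set set" where
  "events_of \<Omega> T Y = {Y t -` A \<inter> space \<Omega> | t A. t \<in> T \<and> A \<in> sets borel}"

definition brownian_motion :: "'a measure \<Rightarrow> (real \<Rightarrow> 'a \<Rightarrow> real) \<Rightarrow> bool" where
  "brownian_motion \<Omega> W \<longleftrightarrow>
     (\<forall>t\<ge>0. W t \<in> borel_measurable \<Omega>) \<and>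
     (AE \<omega> in \<Omega>. W 0 \<omega> = 0) \<and>
     (AE \<omega> in \<Omega>. continuous_on {0..} (\<lambda>t. W t \<omega>)) \<and>
     (\<forall>s t. 0 \<le> s \<and> s < t \<longrightarrow>
        distributed \<Omega> lborel (\<lambda>\<omega>. W t \<omega> - W s \<omega>) (\<lambda>x. ennreal (normal_density 0 (sqrt (t - s)) x))) \<and>
     (\<forall>n (r :: nat \<Rightarrow> real). 0 \<le> r 0 \<and> mono r \<longrightarrow>
        prob_space.indep_vars \<Omega> (\<lambda>_. borel) (\<lambda>i \<omega>. W (r (Suc i)) \<omega> - W (r i) \<omega>) {..<n})"

text \<open>The increment law is written out, since the intensity may be zero.\<close>

definition poisson_process :: "'a measure \<Rightarrow> real \<Rightarrow> (real \<Rightarrow> 'a \<Rightarrow> nat) \<Rightarrow> bool" where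
  "poisson_process \<Omega> lam P \<longleftrightarrow>
     (\<forall>t\<ge>0. P t \<in> measurable \<Omega> (count_space UNIV)) \<and>
     (AE \<omega> in \<Omega>. P 0 \<omega> = 0) \<and>
     (AE \<omega> in \<Omega>. mono_on {0..} (\<lambda>t. P t \<omega>) \<and>
        (\<forall>t\<ge>0. continuous (at_right t) (\<lambda>s. real (P s \<omega>)))) \<and>
     (\<forall>s t k. 0 \<le> s \<and> s < t \<longrightarrow>
        \<P>(\<omega> in \<Omega>. P t \<omega> - P s \<omega> = k) = (lam * (t - s)) ^ k / fact k * exp (- (lam * (t - s)))) \<and>
     (\<forall>n (r :: nat \<Rightarrow> real). 0 \<le> r 0 \<and> mono r \<longrightarrow>
        prob_space.indep_vars \<Omega> (\<lambda>_. count_space UNIV)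
          (\<lambda>i \<omega>. P (r (Suc i)) \<omega> - P (r i) \<omega>) {..<n})"

text \<open>Jump sizes are numbered from 1.\<close>

definition iid_with_cdf :: "'a measure \<Rightarrow> (real \<Rightarrow> real) \<Rightarrow> (nat \<Rightarrow> 'a \<Rightarrow> real) \<Rightarrow> bool" where
  "iid_with_cdf \<Omega> F J \<longleftrightarrow>
     prob_space.indep_vars \<Omega> (\<lambda>_. borel) J {1..} \<and>
     (\<forall>i\<ge>1. cdf (distr \<Omega> borel (J i)) = F)"

definition jump_sum :: "(real \<Rightarrow> 'a \<Rightarrow> nat) \<Rightarrow> (nat \<Rightarrow> 'a \<Rightarrow> real) \<Rightarrow> real \<Rightarrow> 'a \<Rightarrow> real" where
  "jump_sum P J t \<omega> = (\<Sum>i = 1..P t \<omega>. J i \<omega>)"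

definition noise_events ::
  "'a measure \<Rightarrow> (real \<Rightarrow> 'a \<Rightarrow> real) \<Rightarrow> (real \<Rightarrow> 'a \<Rightarrow> nat) \<Rightarrow> (nat \<Rightarrow> 'a \<Rightarrow> real) \<Rightarrow> 'a set set" where
  "noise_events \<Omega> W P J =
     events_of \<Omega> {0..} W \<union> events_of \<Omega> {0..} (\<lambda>t \<omega>. real (P t \<omega>)) \<union> events_of \<Omega> {1..} J"

definition driving_noise ::
  "'a measure \<Rightarrow> real \<Rightarrow> (real \<Rightarrow> real) \<Rightarrow>
   (real \<Rightarrow> 'a \<Rightarrow> real) \<Rightarrow> (real \<Rightarrow> 'a \<Rightarrow> nat) \<Rightarrow> (nat \<Rightarrow> 'a \<Rightarrow> real) \<Rightarrow> bool" where
  "driving_noise \<Omega> lam F W P J \<longleftrightarrow>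
     brownian_motion \<Omega> W \<and> poisson_process \<Omega> lam P \<and> iid_with_cdf \<Omega> F J \<and>
     prob_space.indep_sets \<Omega>
       (\<lambda>i. [sigma_sets (space \<Omega>) (events_of \<Omega> {0..} W),
             sigma_sets (space \<Omega>) (events_of \<Omega> {0..} (\<lambda>t \<omega>. real (P t \<omega>))),
             sigma_sets (space \<Omega>) (events_of \<Omega> {1..} J)] ! i) {..<3::nat}"


section \<open>Strong solutions\<close>

text \<open>The null sets are included so that the filtration is augmented.\<close>

definition noise_filtration ::
  "'a measure \<Rightarrow> (real \<Rightarrow> 'a \<Rightarrow> real) \<Rightarrow> (real \<Rightarrow> 'a \<Rightarrow> nat) \<Rightarrow> (nat \<Rightarrow> 'a \<Rightarrow> real) \<Rightarrow>
   real \<Rightarrow> 'a measure" where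
  "noise_filtration \<Omega> W P J t =
     sigma (space \<Omega>)
       (events_of \<Omega> {0..t} W \<union> events_of \<Omega> {0..t} (\<lambda>s \<omega>. real (P s \<omega>)) \<union>
        events_of \<Omega> {0..t} (jump_sum P J) \<union> null_sets \<Omega>)"

definition adapted :: "(real \<Rightarrow> 'a measure) \<Rightarrow> (real \<Rightarrow> 'a \<Rightarrow> real) \<Rightarrow> bool" where
  "adapted F X \<longleftrightarrow> (\<forall>t\<ge>0. X t \<in> borel_measurable (F t))"

text \<open>Time 0 is left out: it does not matter to an integrand, and the coefficients of interest
  involve densities that need not exist at time 0.\<close>

definition progressive :: "(real \<Rightarrow> 'a measure) \<Rightarrow> (real \<Rightarrow> 'a \<Rightarrow> real) \<Rightarrow> bool" where
  "progressive F H \<longleftrightarrow>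
     (\<forall>t>0. (\<lambda>(s, \<omega>). H s \<omega>) \<in> borel_measurable (restrict_space borel {0<..t} \<Otimes>\<^sub>M F t))"

definition simple_integrand ::
  "nat \<Rightarrow> (nat \<Rightarrow> real) \<Rightarrow> (nat \<Rightarrow> 'a \<Rightarrow> real) \<Rightarrow> real \<Rightarrow> 'a \<Rightarrow> real" where
  "simple_integrand k r \<xi> s \<omega> = (\<Sum>i<k. \<xi> i \<omega> * indicator {r i<..r (Suc i)} s)"

definition simple_integral ::
  "(real \<Rightarrow> 'a \<Rightarrow> real) \<Rightarrow> nat \<Rightarrow> (nat \<Rightarrow> real) \<Rightarrow> (nat \<Rightarrow> 'a \<Rightarrow> real) \<Rightarrow> real \<Rightarrow> 'a \<Rightarrow> real" where
  "simple_integral W k r \<xi> t \<omega> = (\<Sum>i<k. \<xi> i \<omega> * (W (min t (r (Suc i))) \<omega> - W (min t (r i)) \<omega>))"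

definition simple_data ::
  "'a measure \<Rightarrow> (real \<Rightarrow> 'a measure) \<Rightarrow> nat \<Rightarrow> (nat \<Rightarrow> real) \<Rightarrow> (nat \<Rightarrow> 'a \<Rightarrow> real) \<Rightarrow> bool" where
  "simple_data \<Omega> F k r \<xi> \<longleftrightarrow>
     0 \<le> r 0 \<and> mono r \<and>
     (\<forall>i<k. \<xi> i \<in> borel_measurable (F (r i)) \<and> (\<exists>C. \<forall>\<omega>\<in>space \<Omega>. \<bar>\<xi> i \<omega>\<bar> \<le> C))"

text \<open>
  \<open>I\<close> is the Ito integral process of \<open>H\<close> against the Brownian motion \<open>W\<close>: simple integrands
  approximate \<open>H\<close> in probability in the space of square-integrable paths on every \<open>[0,t]\<close>, and
  their integrals converge in probability to \<open>I t\<close>.  Together with path continuity this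
  determines \<open>I\<close> up to indistinguishability.  The approximation can exist only if the paths of
  \<open>H\<close> are almost surely locally square-integrable.
\<close>

definition ito_integral ::
  "'a measure \<Rightarrow> (real \<Rightarrow> 'a measure) \<Rightarrow> (real \<Rightarrow> 'a \<Rightarrow> real) \<Rightarrow>
   (real \<Rightarrow> 'a \<Rightarrow> real) \<Rightarrow> (real \<Rightarrow> 'a \<Rightarrow> real) \<Rightarrow> bool" where
  "ito_integral \<Omega> F W H I \<longleftrightarrow>
     progressive F H \<and> adapted F I \<and>
     (AE \<omega> in \<Omega>. continuous_on {0..} (\<lambda>t. I t \<omega>)) \<and>
     (\<exists>k r \<xi>.
        (\<forall>n :: nat. simple_data \<Omega> F (k n) (r n) (\<xi> n)) \<and>
        (\<forall>t\<ge>0. \<forall>\<epsilon>>0.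
           (\<lambda>n. \<P>(\<omega> in \<Omega>. ennreal \<epsilon> <
              (\<integral>\<^sup>+ s\<in>{0<..t}. ennreal ((simple_integrand (k n) (r n) (\<xi> n) s \<omega> - H s \<omega>)\<^sup>2) \<partial>lborel)))
           \<longlonglongrightarrow> 0) \<and>
        (\<forall>t\<ge>0. \<forall>\<epsilon>>0.
           (\<lambda>n. \<P>(\<omega> in \<Omega>. \<epsilon> < \<bar>simple_integral W (k n) (r n) (\<xi> n) t \<omega> - I t \<omega>\<bar>)) \<longlonglongrightarrow> 0))"

definition cadlag :: "(real \<Rightarrow> real) \<Rightarrow> bool" where
  "cadlag x \<longleftrightarrow> (\<forall>t\<ge>0. continuous (at_right t) x) \<and> (\<forall>t>0. \<exists>l. (x \<longlongrightarrow> l) (at_left t))"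

text \<open>\<open>dX = \<mu>(t, X) dt + \<sigma>(t, X) dW + d(\<Sum>i\<le>P(t). J i)\<close>, \<open>X(0) = x0\<close>, in integrated form.\<close>

definition strong_solution ::
  "'a measure \<Rightarrow> real \<Rightarrow> (real \<Rightarrow> real \<Rightarrow> real) \<Rightarrow> (real \<Rightarrow> real \<Rightarrow> real) \<Rightarrow>
   (real \<Rightarrow> 'a \<Rightarrow> real) \<Rightarrow> (real \<Rightarrow> 'a \<Rightarrow> nat) \<Rightarrow> (nat \<Rightarrow> 'a \<Rightarrow> real) \<Rightarrow>
   (real \<Rightarrow> 'a \<Rightarrow> real) \<Rightarrow> bool" where
  "strong_solution \<Omega> x0 \<mu> \<sigma> W P J X \<longleftrightarrow>
     (let F = noise_filtration \<Omega> W P J in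
      adapted F X \<and> progressive F X \<and>
      (AE \<omega> in \<Omega>. cadlag (\<lambda>t. X t \<omega>)) \<and>
      progressive F (\<lambda>t \<omega>. \<mu> t (X t \<omega>)) \<and>
      (AE \<omega> in \<Omega>. \<forall>t\<ge>0. set_integrable lborel {0<..t} (\<lambda>s. \<mu> s (X s \<omega>))) \<and>
      (\<exists>I. ito_integral \<Omega> F W (\<lambda>t \<omega>. \<sigma> t (X t \<omega>)) I \<and>
         (AE \<omega> in \<Omega>. \<forall>t\<ge>0.
            X t \<omega> = x0 + (LBINT s:{0<..t}. \<mu> s (X s \<omega>)) + I t \<omega> + jump_sum P J t \<omega>)))"


section \<open>Switching at fixed times\<close>

text \<open>A list \<open>z\<close> of \<open>m\<close> sojourn times encodes \<open>(z 1, \<dots>, z m)\<close>, so \<open>z k\<close> is \<open>z ! (k - 1)\<close>;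
  a list \<open>\<theta>\<close> of \<open>m + 1\<close> parameters encodes \<open>(\<theta> 0, \<dots>, \<theta> m)\<close>.\<close>

definition switch_time :: "real list \<Rightarrow> nat \<Rightarrow> ereal" where
  "switch_time z j = (if j \<le> length z then ereal (sum_list (take j z)) else \<infinity>)"

definition local_time :: "real list \<Rightarrow> nat \<Rightarrow> real \<Rightarrow> real" where
  "local_time z j t =
     (if ereal t < switch_time z j then 0
      else if ereal t < switch_time z (Suc j) then t - real_of_ereal (switch_time z j)
      else real_of_ereal (switch_time z (Suc j) - switch_time z j))"

definition switched ::
  "(nat \<Rightarrow> real \<Rightarrow> real \<Rightarrow> real) \<Rightarrow> real list \<Rightarrow> real list \<Rightarrow> real \<Rightarrow> real" where
  "switched c z \<theta> t =
     (\<Sum>j\<le>length z. c j (local_time z j t) (\<theta> ! j) *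
        indicator {switch_time z j..<switch_time z (Suc j)} (ereal t))"


section \<open>Quadrature over sojourn times and parameters\<close>

text \<open>\<open>par_node j n\<close> and \<open>par_weight j n\<close> are \<open>\<theta>\<^sub>j\<^sub>,\<^sub>n\<close> and \<open>w\<^sub>j\<^sub>,\<^sub>n\<close> for \<open>1 \<le> n \<le> par_size j\<close>.
  The sojourn nodes and weights depend on the preceding indices:
  \<open>soj_node [l1, \<dots>, lk]\<close> is the node with subscript \<open>lk\<close> and superscripts \<open>l1, \<dots>, l(k-1)\<close>,
  where \<open>1 \<le> li \<le> soj_size i\<close>; likewise \<open>soj_weight\<close>.\<close>

record quadrature =
  par_size :: "nat \<Rightarrow> nat"
  par_node :: "nat \<Rightarrow> nat \<Rightarrow> real"
  par_weight :: "nat \<Rightarrow> nat \<Rightarrow> real"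
  soj_size :: "nat \<Rightarrow> nat"
  soj_node :: "nat list \<Rightarrow> real"
  soj_weight :: "nat list \<Rightarrow> real"

definition soj_indices :: "quadrature \<Rightarrow> nat \<Rightarrow> nat list set" where
  "soj_indices Q k = {l. length l = k \<and> (\<forall>i<k. l ! i \<in> {1..soj_size Q (Suc i)})}"

definition par_indices :: "quadrature \<Rightarrow> nat \<Rightarrow> nat list set" where
  "par_indices Q m = {n. length n = Suc m \<and> (\<forall>j\<le>m. n ! j \<in> {1..par_size Q j})}"

definition valid_quadrature :: "nat \<Rightarrow> quadrature \<Rightarrow> bool" where
  "valid_quadrature m Q \<longleftrightarrow>
     (\<forall>j\<le>m. (\<forall>n\<in>{1..par_size Q j}. 0 \<le> par_weight Q j n) \<and>
        (\<Sum>n = 1..par_size Q j. par_weight Q j n) = 1) \<and>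
     (\<forall>k\<in>{1..m}. \<forall>l\<in>soj_indices Q k. 0 < soj_node Q l \<and> 0 < soj_weight Q l) \<and>
     (\<forall>k\<in>{1..m}. \<forall>l\<in>soj_indices Q (k - 1).
        (\<Sum>a = 1..soj_size Q k. soj_weight Q (l @ [a])) = 1)"

definition soj_vec :: "quadrature \<Rightarrow> nat list \<Rightarrow> real list" where
  "soj_vec Q l = map (\<lambda>k. soj_node Q (take k l)) [1..<Suc (length l)]"

definition soj_prod :: "quadrature \<Rightarrow> nat list \<Rightarrow> real" where
  "soj_prod Q l = (\<Prod>k = 1..length l. soj_weight Q (take k l))"

definition par_vec :: "quadrature \<Rightarrow> nat list \<Rightarrow> real list" where
  "par_vec Q n = map (\<lambda>j. par_node Q j (n ! j)) [0..<length n]"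

definition par_prod :: "quadrature \<Rightarrow> nat list \<Rightarrow> real" where
  "par_prod Q n = (\<Prod>j<length n. par_weight Q j (n ! j))"

text \<open>\<open>f z \<theta> t\<close> is the density of the switched process with data \<open>z, \<theta>\<close> at time \<open>t\<close>.  For \<open>m = 0\<close>
  the only sojourn index is \<open>[]\<close>, with weight 1.\<close>

definition mixture ::
  "nat \<Rightarrow> quadrature \<Rightarrow> (real list \<Rightarrow> real list \<Rightarrow> real \<Rightarrow> real \<Rightarrow> real) \<Rightarrow>
   (real list \<Rightarrow> real list \<Rightarrow> real) \<Rightarrow> real \<Rightarrow> real \<Rightarrow> real" where
  "mixture m Q f g t x =
     (\<Sum>l\<in>soj_indices Q m. \<Sum>n\<in>par_indices Q m.
        soj_prod Q l * par_prod Q n * g (soj_vec Q l) (par_vec Q n) *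
        f (soj_vec Q l) (par_vec Q n) t x)"

definition local_drift ::
  "nat \<Rightarrow> quadrature \<Rightarrow> (real list \<Rightarrow> real list \<Rightarrow> real \<Rightarrow> real \<Rightarrow> real) \<Rightarrow>
   (nat \<Rightarrow> real \<Rightarrow> real \<Rightarrow> real) \<Rightarrow> real \<Rightarrow> real \<Rightarrow> real" where
  "local_drift m Q f b t x =
     mixture m Q f (\<lambda>z \<theta>. switched b z \<theta> t) t x / mixture m Q f (\<lambda>z \<theta>. 1) t x"

definition local_volatility ::
  "nat \<Rightarrow> quadrature \<Rightarrow> (real list \<Rightarrow> real list \<Rightarrow> real \<Rightarrow> real \<Rightarrow> real) \<Rightarrow>
   (nat \<Rightarrow> real \<Rightarrow> real \<Rightarrow> real) \<Rightarrow> real \<Rightarrow> real \<Rightarrow> real" where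
  "local_volatility m Q f \<sigma> t x =
     sqrt (mixture m Q f (\<lambda>z \<theta>. (switched \<sigma> z \<theta> t)\<^sup>2) t x / mixture m Q f (\<lambda>z \<theta>. 1) t x)"


section \<open>Random number of switches\<close>

text \<open>\<open>K t\<close> has values in \<open>{0..M}\<close> and the distribution of the number of switches up to time \<open>t\<close>
  when the sojourn times are \<open>\<zeta> 1, \<dots>, \<zeta> M\<close>.\<close>

definition switch_number ::
  "'a measure \<Rightarrow> nat \<Rightarrow> (nat \<Rightarrow> 'a \<Rightarrow> real) \<Rightarrow> (real \<Rightarrow> 'a \<Rightarrow> nat) \<Rightarrow> bool" where
  "switch_number \<Omega> M \<zeta> K \<longleftrightarrow>
     (\<forall>t\<ge>0. K t \<in> measurable \<Omega> (count_space UNIV) \<and>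
        (\<forall>\<omega>\<in>space \<Omega>. K t \<omega> \<in> {0..M}) \<and>
        (\<forall>m<M. \<P>(\<omega> in \<Omega>. K t \<omega> \<le> m) = 1 - \<P>(\<omega> in \<Omega>. (\<Sum>l = 1..m + 1. \<zeta> l \<omega>) \<le> t)))"

text \<open>Conditioning is elementary, hence imposed only for values of positive probability.\<close>

definition fully_stochastic_switching ::
  "'a measure \<Rightarrow> nat \<Rightarrow> (real \<Rightarrow> 'a \<Rightarrow> nat) \<Rightarrow> (nat \<Rightarrow> real \<Rightarrow> 'a \<Rightarrow> real) \<Rightarrow>
   (real \<Rightarrow> 'a \<Rightarrow> real) \<Rightarrow> bool" where
  "fully_stochastic_switching \<Omega> M K Xhat Y \<longleftrightarrow>
     (\<forall>t\<ge>0. Y t \<in> borel_measurable \<Omega> \<and>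
        (\<forall>m\<le>M. 0 < \<P>(\<omega> in \<Omega>. K t \<omega> = m) \<longrightarrow>
           (\<forall>A\<in>sets borel.
              \<P>(\<omega> in \<Omega>. Y t \<omega> \<in> A \<bar> K t \<omega> = m) = \<P>(\<omega> in \<Omega>. Xhat m t \<omega> \<in> A))))"

definition mass_function :: "'a measure \<Rightarrow> ('a \<Rightarrow> nat) \<Rightarrow> nat \<Rightarrow> real" where
  "mass_function \<Omega> K m = \<P>(\<omega> in \<Omega>. K \<omega> = m)"

definition characteristic_function :: "'a measure \<Rightarrow> ('a \<Rightarrow> real) \<Rightarrow> real \<Rightarrow> complex" where
  "characteristic_function \<Omega> Z u = char (distr \<Omega> borel Z) u"

lemma characteristic_function_eq_expectation:
  assumes "Z \<in> borel_measurable \<Omega>"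
  shows "characteristic_function \<Omega> Z u = (CLINT \<omega>|\<Omega>. iexp (u * Z \<omega>))"
  unfolding characteristic_function_def char_def
  using assms by (intro integral_distr) auto

end

theory Submission
  imports Defs
begin

text \<open>This is the law of total expectation for the bounded function
  \<open>iexp (u * Xtilde t \<omega>)\<close>. The events where \<open>K t = m\<close>, for m = 0,
  ..., M, partition the space. On each of them the conditional law of \<open>Xtilde t\<close> is the
  law of \<open>Xhat m t\<close>, so the integral over that event is its probability times the
  characteristic function of \<open>Xhat m t\<close>; summing over m gives the formula.
  \<open>integral_indicator_mult_product_law\<close> treats one event and
  \<open>char_distr_mixture\<close> sums over the partition. It remains to see that each
  \<open>Xhat m t\<close> is a random variable on the whole space. This is
  \<open>strong_solution_measurable\<close>: a solution is adapted to the noise filtration, and that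
  filtration consists of events.\<close>

lemma (in prob_space) integral_indicator_mult_product_law:
  fixes X Y :: "'a \<Rightarrow> real" and g :: "real \<Rightarrow> complex"
  assumes [measurable]: "E \<in> events" "X \<in> borel_measurable M" "Y \<in> borel_measurable M"
      "g \<in> borel_measurable borel"
    and law: "\<And>A. A \<in> sets borel \<Longrightarrow>
      prob ({\<omega> \<in> space M. Y \<omega> \<in> A} \<inter> E) = prob E * prob {\<omega> \<in> space M. X \<omega> \<in> A}"
  shows "(CLINT \<omega>|M. indicator E \<omega> *\<^sub>R g (Y \<omega>)) = prob E *\<^sub>R (CLINT \<omega>|M. g (X \<omega>))"
proof -
  \<comment> \<open>The hypothesis \<open>law\<close> says that two finite measures on the line
    agree: the image under \<open>Y\<close> of \<open>M\<close> restricted to \<open>E\<close>, and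
    the law of \<open>X\<close> scaled by \<open>prob E\<close>. Integrating \<open>g\<close>
    against both gives the claim. The product form of \<open>law\<close>, in place of a conditional
    probability, also covers events \<open>E\<close> of probability 0.\<close>
  have eq: "distr (density M (\<lambda>\<omega>. ennreal (indicator E \<omega>))) borel Y =
      density (distr M borel X) (\<lambda>_. ennreal (prob E))" (is "?L = ?R")
  proof (rule measure_eqI)
    fix A assume "A \<in> sets ?L"
    then have [measurable]: "A \<in> sets borel" by simp
    have "emeasure ?L A = emeasure (density M (indicator E)) (Y -` A \<inter> space M)"
      by (simp add: emeasure_distr ennreal_indicator)
    also have "\<dots> = emeasure M (E \<inter> (Y -` A \<inter> space M))"
      by (rule emeasure_restricted) measurable
    also have "E \<inter> (Y -` A \<inter> space M) = {\<omega> \<in> space M. Y \<omega> \<in> A} \<inter> E"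
      by blast
    also have "emeasure M \<dots> = ennreal (prob E) * emeasure M {\<omega> \<in> space M. X \<omega> \<in> A}"
      by (simp add: emeasure_eq_measure law ennreal_mult)
    also have "\<dots> = emeasure ?R A"
      by (simp add: emeasure_density_const emeasure_distr vimage_def Int_def conj_commute)
    finally show "emeasure ?L A = emeasure ?R A" .
  qed simp
  have "(CLINT \<omega>|M. indicator E \<omega> *\<^sub>R g (Y \<omega>)) = integral\<^sup>L ?L g"
    by (simp add: integral_distr integral_density)
  also have "\<dots> = prob E *\<^sub>R (CLINT \<omega>|M. g (X \<omega>))"
    by (simp add: eq integral_distr integral_density)
  finally show ?thesis .
qed

text \<open>A finite mixture of laws has the corresponding mixture of characteristic functions. The
  premise \<open>cond\<close> is restricted to values of \<open>K\<close> with positive probability,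
  as elementary conditioning demands; the other values get weight 0 in the sum.\<close>

lemma (in prob_space) char_distr_mixture:
  fixes X :: "nat \<Rightarrow> 'a \<Rightarrow> real" and Y :: "'a \<Rightarrow> real"
  assumes [measurable]: "K \<in> measurable M (count_space UNIV)" "Y \<in> borel_measurable M"
    and K_le: "\<And>\<omega>. \<omega> \<in> space M \<Longrightarrow> K \<omega> \<le> k"
    and X: "\<And>m. m \<le> k \<Longrightarrow> X m \<in> borel_measurable M"
    and cond: "\<And>m A. m \<le> k \<Longrightarrow> 0 < \<P>(\<omega> in M. K \<omega> = m) \<Longrightarrow> A \<in> sets borel \<Longrightarrow>
      \<P>(\<omega> in M. Y \<omega> \<in> A \<bar> K \<omega> = m) = \<P>(\<omega> in M. X m \<omega> \<in> A)"
  shows "char (distr M borel Y) u =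
    (\<Sum>m = 0..k. char (distr M borel (X m)) u * complex_of_real (\<P>(\<omega> in M. K \<omega> = m)))"
proof -
  define E where "E m = {\<omega> \<in> space M. K \<omega> = m}" for m
  have E [measurable]: "E m \<in> events" for m
    unfolding E_def by measurable
  have law: "prob ({\<omega> \<in> space M. Y \<omega> \<in> A} \<inter> E m) = prob (E m) * prob {\<omega> \<in> space M. X m \<omega> \<in> A}"
    if "m \<le> k" and [measurable]: "A \<in> sets borel" for m A
  \<comment> \<open>On a null event \<open>cond\<close> says nothing, but both sides vanish.
    Otherwise the conditional probability is multiplied by \<open>prob (E m)\<close>.\<close>
  proof (cases "prob (E m) = 0")
    case True
    have "prob ({\<omega> \<in> space M. Y \<omega> \<in> A} \<inter> E m) \<le> prob (E m)"
      by (rule finite_measure_mono) auto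
    with True show ?thesis by (simp add: measure_le_0_iff)
  next
    case False
    then have "0 < prob (E m)" by (simp add: zero_less_measure_iff)
    moreover have "{\<omega> \<in> space M. Y \<omega> \<in> A \<and> K \<omega> = m} = {\<omega> \<in> space M. Y \<omega> \<in> A} \<inter> E m"
      by (auto simp: E_def)
    ultimately show ?thesis
      using cond[OF that(1) _ that(2)] by (simp add: E_def cond_prob_def field_simps)
  qed
  have split: "iexp (u * Y \<omega>) = (\<Sum>m = 0..k. indicator (E m) \<omega> *\<^sub>R iexp (u * Y \<omega>))"
    if "\<omega> \<in> space M" for \<omega>
  proof -
    have "(\<Sum>m = 0..k. indicator (E m) \<omega> *\<^sub>R iexp (u * Y \<omega>)) =
        (\<Sum>m = 0..k. if m = K \<omega> then iexp (u * Y \<omega>) else 0)"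
      using that by (intro sum.cong) (auto simp: E_def)
    \<comment> \<open>Exactly one summand survives, the one at \<open>m = K \<omega>\<close>; the
      bound \<open>K_le\<close> guarantees that this index lies in the range of summation.\<close>
    then show ?thesis
      using K_le[OF that] by simp
  qed
  have "char (distr M borel Y) u = (CLINT \<omega>|M. iexp (u * Y \<omega>))"
    unfolding char_def by (rule integral_distr) measurable
  also have "\<dots> = (CLINT \<omega>|M. (\<Sum>m = 0..k. indicator (E m) \<omega> *\<^sub>R iexp (u * Y \<omega>)))"
    by (rule Bochner_Integration.integral_cong[OF refl split])
  also have "\<dots> = (\<Sum>m = 0..k. CLINT \<omega>|M. indicator (E m) \<omega> *\<^sub>R iexp (u * Y \<omega>))"
  proof (rule Bochner_Integration.integral_sum)
    fix m
    show "integrable M (\<lambda>\<omega>. indicator (E m) \<omega> *\<^sub>R iexp (u * Y \<omega>))"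
    \<comment> \<open>Values of \<open>iexp\<close> have modulus 1, and a bounded measurable
      function is integrable on a probability space.\<close>
    proof (rule integrable_const_bound[where B = 1])
      show "AE \<omega> in M. norm (indicator (E m) \<omega> *\<^sub>R iexp (u * Y \<omega>)) \<le> 1"
        by (intro AE_I2) (simp add: indicator_def)
    qed measurable
  qed
  also have "\<dots> = (\<Sum>m = 0..k. prob (E m) *\<^sub>R (CLINT \<omega>|M. iexp (u * X m \<omega>)))"
  proof (intro sum.cong refl)
    fix m assume "m \<in> {0..k}"
    then have "m \<le> k" by simp
    show "(CLINT \<omega>|M. indicator (E m) \<omega> *\<^sub>R iexp (u * Y \<omega>)) =
        prob (E m) *\<^sub>R (CLINT \<omega>|M. iexp (u * X m \<omega>))"
      by (rule integral_indicator_mult_product_law[where g = "\<lambda>y. iexp (u * y)", OF E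
          X[OF \<open>m \<le> k\<close>] \<open>Y \<in> borel_measurable M\<close> _ law[OF \<open>m \<le> k\<close>]]) simp_all
  qed
  also have "\<dots> = (\<Sum>m = 0..k. char (distr M borel (X m)) u * complex_of_real (prob (E m)))"
  proof (intro sum.cong refl)
    fix m assume "m \<in> {0..k}"
    then have [measurable]: "X m \<in> borel_measurable M" using X by simp
    have "char (distr M borel (X m)) u = (CLINT \<omega>|M. iexp (u * X m \<omega>))"
      unfolding char_def by (rule integral_distr) measurable
    then show "prob (E m) *\<^sub>R (CLINT \<omega>|M. iexp (u * X m \<omega>)) =
        char (distr M borel (X m)) u * complex_of_real (prob (E m))"
      by (simp add: scaleR_conv_of_real)
  qed
  finally show ?thesis by (simp add: E_def)
qed

text \<open>The number of summands is random but takes countably many values, and for each fixed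
  number the sum is measurable.\<close>

lemma jump_sum_measurable:
  assumes P: "P t \<in> measurable \<Omega> (count_space UNIV)"
    and J: "\<And>i. 1 \<le> i \<Longrightarrow> J i \<in> borel_measurable \<Omega>"
  shows "jump_sum P J t \<in> borel_measurable \<Omega>"
proof -
  have "(\<lambda>\<omega>. (\<lambda>k \<omega>. \<Sum>i = 1..k. J i \<omega>) (P t \<omega>) \<omega>) \<in> borel_measurable \<Omega>"
    by (rule measurable_compose_countable[OF borel_measurable_sum P]) (use J in auto)
  then show ?thesis
    unfolding jump_sum_def[abs_def] .
qed

lemma (in prob_space) driving_noise_measurable:
  assumes "driving_noise M lam F W P J"
  shows "0 \<le> t \<Longrightarrow> W t \<in> borel_measurable M"
    and "0 \<le> t \<Longrightarrow> P t \<in> measurable M (count_space UNIV)"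
    and "1 \<le> i \<Longrightarrow> J i \<in> borel_measurable M"
proof -
  have W: "brownian_motion M W" and P: "poisson_process M lam P" and J: "iid_with_cdf M F J"
    using assms unfolding driving_noise_def by blast+
  show "0 \<le> t \<Longrightarrow> W t \<in> borel_measurable M"
    using W[unfolded brownian_motion_def, THEN conjunct1] by blast
  show "0 \<le> t \<Longrightarrow> P t \<in> measurable M (count_space UNIV)"
    using P[unfolded poisson_process_def, THEN conjunct1] by blast
  \<comment> \<open>Independence of the jump sizes includes, as its first conjunct, the
    measurability of each of them.\<close>
  show "1 \<le> i \<Longrightarrow> J i \<in> borel_measurable M"
    using J[unfolded iid_with_cdf_def indep_vars_def, THEN conjunct1, THEN conjunct1] by simp
qed

lemma events_of_subset_sets:
  assumes "\<And>t. t \<in> T \<Longrightarrow> Y t \<in> borel_measurable \<Omega>"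
  shows "events_of \<Omega> T Y \<subseteq> sets \<Omega>"
proof
  fix E assume "E \<in> events_of \<Omega> T Y"
  then obtain t A where "t \<in> T" "A \<in> sets borel" "E = Y t -` A \<inter> space \<Omega>"
    unfolding events_of_def by blast
  then show "E \<in> sets \<Omega>"
    using assms[of t] by (simp add: measurable_sets)
qed

text \<open>Every generator is already an event: the noise and the jump sums are measurable at each
  nonnegative time, and the augmentation adds only members of \<open>null_sets M\<close>, which are
  measurable by definition.\<close>

lemma (in prob_space) subalgebra_noise_filtration:
  assumes noise: "driving_noise M lam F W P J"
  shows "subalgebra M (noise_filtration M W P J t)"
proof -
  let ?G = "events_of M {0..t} W \<union> events_of M {0..t} (\<lambda>s \<omega>. real (P s \<omega>)) \<union>
    events_of M {0..t} (jump_sum P J) \<union> null_sets M"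
  have "(\<lambda>\<omega>. real (P s \<omega>)) \<in> borel_measurable M" if "0 \<le> s" for s
    using driving_noise_measurable(2)[OF noise that] by (rule measurable_compose) simp
  moreover have "jump_sum P J s \<in> borel_measurable M" if "0 \<le> s" for s
    using driving_noise_measurable(2)[OF noise that] driving_noise_measurable(3)[OF noise]
    by (rule jump_sum_measurable)
  moreover have "null_sets M \<subseteq> sets M"
    by (simp add: null_sets_def)
  ultimately have "?G \<subseteq> sets M"
    using driving_noise_measurable(1)[OF noise]
    by (intro Un_least events_of_subset_sets) simp_all
  then have "sets (sigma (space M) ?G) \<subseteq> sets M"
    using sigma_le_sets[of ?G "space M" M] sets.space_closed[of M] by blast
  then show ?thesis
    by (simp add: subalgebra_def noise_filtration_def space_measure_of_conv)
qed

text \<open>Adaptedness gives measurability for the filtration at time \<open>t\<close>, and this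
  passes to the larger sigma-algebra of all events.\<close>

lemma (in prob_space) strong_solution_measurable:
  assumes "driving_noise M lam F W P J" and "strong_solution M x0 \<mu> \<sigma> W P J X" and "0 \<le> t"
  shows "X t \<in> borel_measurable M"
proof -
  have "X t \<in> borel_measurable (noise_filtration M W P J t)"
    using assms(2,3) unfolding strong_solution_def adapted_def Let_def by blast
  then show ?thesis
    by (rule measurable_from_subalg[OF subalgebra_noise_filtration[OF assms(1)]])
qed

theorem proposition4p4:
  fixes \<Omega> :: "'a measure"
    and M :: nat and x0 lam :: real and F\<eta> :: "real \<Rightarrow> real"
    and b \<sigma> :: "nat \<Rightarrow> real \<Rightarrow> real \<Rightarrow> real"
    and Q :: "nat \<Rightarrow> quadrature"
    and W What :: "real \<Rightarrow> 'a \<Rightarrow> real" and P Nhat :: "real \<Rightarrow> 'a \<Rightarrow> nat"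
    and \<pi>jump \<eta>hat :: "nat \<Rightarrow> 'a \<Rightarrow> real"
    and X :: "real list \<Rightarrow> real list \<Rightarrow> real \<Rightarrow> 'a \<Rightarrow> real"
    and f :: "real list \<Rightarrow> real list \<Rightarrow> real \<Rightarrow> real \<Rightarrow> real"
    and Xhat :: "nat \<Rightarrow> real \<Rightarrow> 'a \<Rightarrow> real"
    and \<zeta> :: "nat \<Rightarrow> 'a \<Rightarrow> real" and K :: "real \<Rightarrow> 'a \<Rightarrow> nat"
    and Xtilde :: "real \<Rightarrow> 'a \<Rightarrow> real"
    and t u :: real
  assumes "prob_space \<Omega>"
    and "0 \<le> lam"
    and bounded_coeffs:
      "\<And>j s. j \<le> M \<Longrightarrow> 0 \<le> s \<Longrightarrow> bounded (range (b j s)) \<and> bounded (range (\<sigma> j s))"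
    and "\<And>m. m \<le> M \<Longrightarrow> valid_quadrature m (Q m)"
    and "driving_noise \<Omega> lam F\<eta> W P \<pi>jump"
    and "driving_noise \<Omega> lam F\<eta> What Nhat \<eta>hat"
    and X_solution: "\<And>m l n. m \<le> M \<Longrightarrow> l \<in> soj_indices (Q m) m \<Longrightarrow> n \<in> par_indices (Q m) m \<Longrightarrow>
        strong_solution \<Omega> x0
          (\<lambda>s x. switched b (soj_vec (Q m) l) (par_vec (Q m) n) s)
          (\<lambda>s x. switched \<sigma> (soj_vec (Q m) l) (par_vec (Q m) n) s)
          W P \<pi>jump (X (soj_vec (Q m) l) (par_vec (Q m) n))"
    and f_density: "\<And>m l n s. m \<le> M \<Longrightarrow> l \<in> soj_indices (Q m) m \<Longrightarrow> n \<in> par_indices (Q m) m \<Longrightarrow> 0 < s \<Longrightarrow>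
        (\<forall>x. 0 \<le> f (soj_vec (Q m) l) (par_vec (Q m) n) s x) \<and>
        distributed \<Omega> lborel (X (soj_vec (Q m) l) (par_vec (Q m) n) s)
          (\<lambda>x. ennreal (f (soj_vec (Q m) l) (par_vec (Q m) n) s x))"
    and Xhat_solution: "\<And>m. m \<le> M \<Longrightarrow>
        strong_solution \<Omega> x0 (local_drift m (Q m) f b) (local_volatility m (Q m) f \<sigma>)
          What Nhat \<eta>hat (Xhat m)"
    and \<zeta>_positive: "\<And>l. l \<in> {1..M} \<Longrightarrow> AE \<omega> in \<Omega>. 0 < \<zeta> l \<omega>"
    and \<zeta>_indep: "prob_space.indep_vars \<Omega> (\<lambda>_. borel) \<zeta> {1..M}"
    and \<zeta>_noise_indep: "prob_space.indep_set \<Omega>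
        (sigma_sets (space \<Omega>) (events_of \<Omega> {1..M} \<zeta>))
        (sigma_sets (space \<Omega>) (noise_events \<Omega> W P \<pi>jump \<union> noise_events \<Omega> What Nhat \<eta>hat))"
    and "switch_number \<Omega> M \<zeta> K"
    and "fully_stochastic_switching \<Omega> M K Xhat Xtilde"
    and "0 \<le> t"
  shows "characteristic_function \<Omega> (Xtilde t) u =
    (\<Sum>m = 0..M. characteristic_function \<Omega> (Xhat m t) u * complex_of_real (mass_function \<Omega> (K t) m))"
proof -
  interpret prob_space \<Omega> by fact
  have Y: "Xtilde t \<in> borel_measurable \<Omega>"
    using \<open>fully_stochastic_switching \<Omega> M K Xhat Xtilde\<close> \<open>0 \<le> t\<close>
    by (simp add: fully_stochastic_switching_def)
  have cond: "\<P>(\<omega> in \<Omega>. Xtilde t \<omega> \<in> A \<bar> K t \<omega> = m) = \<P>(\<omega> in \<Omega>. Xhat m t \<omega> \<in> A)"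
      if "m \<le> M" "0 < \<P>(\<omega> in \<Omega>. K t \<omega> = m)" "A \<in> sets borel" for m A
    using \<open>fully_stochastic_switching \<Omega> M K Xhat Xtilde\<close> \<open>0 \<le> t\<close> that
    by (simp add: fully_stochastic_switching_def)
  have K: "K t \<in> measurable \<Omega> (count_space UNIV)"
    and K_le: "\<And>\<omega>. \<omega> \<in> space \<Omega> \<Longrightarrow> K t \<omega> \<le> M"
    using \<open>switch_number \<Omega> M \<zeta> K\<close> \<open>0 \<le> t\<close> by (auto simp: switch_number_def)
  \<comment> \<open>Measurability is what allows \<open>char\<close> of the image measure to be read
    as an expectation over \<open>\<Omega>\<close>.\<close>
  have Xhat: "Xhat m t \<in> borel_measurable \<Omega>" if "m \<le> M" for m
    using strong_solution_measurable[OF \<open>driving_noise \<Omega> lam F\<eta> What Nhat \<eta>hat\<close>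
        Xhat_solution[OF that] \<open>0 \<le> t\<close>] .
  show ?thesis
    unfolding characteristic_function_def mass_function_def
    using K Y K_le Xhat cond by (rule char_distr_mixture[where X = "\<lambda>m. Xhat m t"])
qed

end
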